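(* There exists a numerical constant $c>0$ such that for all integers $p\ge q\ge 1$, $$\inf_{\widehat T}\ \sup_{\mathbf A\in\mathbb R^{p\times q}:\ \mathrm{rank}(\mathbf A)\le 1}\mathbb E\big[\,|\widehat T-\|\mathbf A\|_2|\,\big]\ \ge\ c\,(pq)^{1/4}.$$
   Context: $\mathbf Y=\mathbf A+\mathbf E$, where $\mathbf A$ is a deterministic real $p\times q$ matrix and $\mathbf E$ is a $p\times q$ random matrix with independent standard normal entries. The infimum is over all estimators $\widehat T$, i.e. all real-valued measurable functions of $\mathbf Y$, and the expectation is with respect to the law of $\mathbf Y$ with parameter $\mathbf A$. $\|\cdot\|_2$ is the Frobenius norm. *)

theory Defs
  imports "HOL-Probability.Probability" "Jordan_Normal_Form.DL_Rank"
begin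

text \<open>
  The dimensions \<open>p\<close> and \<open>q\<close> are quantified inside the statement, so they are terms and not types.
  Deterministic matrices are elements of \<open>carrier_mat p q\<close>. An observed matrix is given by the
  family of its entries, a point of the product space \<open>obs_space p q\<close>: an extensional function on
  the index set, indexed from 0, with the product (Borel) sigma-algebra.
\<close>

definition entries :: "nat \<Rightarrow> nat \<Rightarrow> (nat \<times> nat) set" where
  "entries p q = {..<p} \<times> {..<q}"

definition obs_space :: "nat \<Rightarrow> nat \<Rightarrow> (nat \<times> nat \<Rightarrow> real) measure" where
  "obs_space p q = (\<Pi>\<^sub>M ij\<in>entries p q. borel)"

definition noise_law :: "nat \<Rightarrow> nat \<Rightarrow> (nat \<times> nat \<Rightarrow> real) measure" where
  "noise_law p q =
     (\<Pi>\<^sub>M ij\<in>entries p q. density lborel (\<lambda>x. ennreal (std_normal_density x)))"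

text \<open>The law of \<open>Y = A + E\<close>, where \<open>E\<close> has law \<open>noise_law p q\<close>.\<close>

definition obs_law :: "nat \<Rightarrow> nat \<Rightarrow> real mat \<Rightarrow> (nat \<times> nat \<Rightarrow> real) measure" where
  "obs_law p q A =
     distr (noise_law p q) (obs_space p q) (\<lambda>E. \<lambda>ij\<in>entries p q. A $$ ij + E ij)"

definition frobenius_norm :: "real mat \<Rightarrow> real" where
  "frobenius_norm A = sqrt (\<Sum>i<dim_row A. \<Sum>j<dim_col A. (A $$ (i, j))\<^sup>2)"

text \<open>The risk is valued in \<open>ennreal\<close>, since no integrability is required of an estimator \<open>T\<close>.\<close>

definition risk :: "nat \<Rightarrow> nat \<Rightarrow> ((nat \<times> nat \<Rightarrow> real) \<Rightarrow> real) \<Rightarrow> real mat \<Rightarrow> ennreal" where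
  "risk p q T A = (\<integral>\<^sup>+ Y. ennreal \<bar>T Y - frobenius_norm A\<bar> \<partial>obs_law p q A)"

end

theory Submission
  imports Defs
begin

text \<open>
  The norm cannot be estimated better than the distance between two hypotheses that the data cannot
  tell apart. Here the null matrix is compared with a random matrix \<open>s \<epsilon> \<eta>\<^sup>T\<close>, where
  \<open>\<epsilon>\<close> and \<open>\<eta>\<close> are independent uniform sign vectors of lengths \<open>p\<close> and \<open>q\<close>. It has rank one,
  and its Frobenius norm is \<open>s \<surd>(p q)\<close> whatever the signs are.

  Let \<open>L\<close> be the likelihood ratio of the mixture of the shifted Gaussian laws to pure noise. Since
  the product of two Gaussian likelihood ratios with shifts \<open>a\<close> and \<open>b\<close> has mean
  \<open>exp \<langle>a, b\<rangle>\<close> (\<open>nn_integral_shift_lr_mult\<close>), the second moment of \<open>L\<close> is the mean of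
  \<open>exp (s\<^sup>2 V W)\<close>, where \<open>V\<close> and \<open>W\<close> are independent sums of \<open>p\<close> and of \<open>q\<close> random signs.
  Subgaussianity of \<open>V\<close> bounds this by the mean of \<open>exp (p s^4 W\<^sup>2 / 2)\<close>, and \<open>W\<^sup>2\<close> has order \<open>q\<close>;
  so the second moment stays bounded as long as \<open>s^4 p q\<close> does. With \<open>s^4 p q = 1/4\<close> it is at most
  2 (\<open>sum_signs_exp_bilinear_le\<close>), which forces the two hypotheses to overlap
  (\<open>two_point_risk_bound\<close>, \<open>mixture_risk_bound\<close>). Their norms differ by
  \<open>s \<surd>(p q) = (p q)\<^sup>1\<^sup>/\<^sup>4 / \<surd>2\<close>, and a quarter of this difference is a lower bound for the
  maximal risk of every estimator.
\<close>

section \<open>Likelihood ratios of shifted Gaussian vectors\<close>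

abbreviation std_gauss :: "real measure" where
  "std_gauss \<equiv> density lborel (\<lambda>x. ennreal (std_normal_density x))"

definition gauss_shift :: "'i set \<Rightarrow> ('i \<Rightarrow> real) \<Rightarrow> ('i \<Rightarrow> real) measure" where
  "gauss_shift I a = distr (\<Pi>\<^sub>M i\<in>I. std_gauss) (\<Pi>\<^sub>M i\<in>I. borel) (\<lambda>E. \<lambda>i\<in>I. a i + E i)"

definition shift_lr :: "'i set \<Rightarrow> ('i \<Rightarrow> real) \<Rightarrow> ('i \<Rightarrow> real) \<Rightarrow> real" where
  "shift_lr I a x = exp (\<Sum>i\<in>I. a i * x i - (a i)\<^sup>2 / 2)"

lemma prob_space_std_gauss: "prob_space std_gauss"
  by (rule prob_space_normal_density) simp

lemma sets_PiM_std_gauss: "sets (\<Pi>\<^sub>M i\<in>I. std_gauss) = sets (\<Pi>\<^sub>M i\<in>I. borel)"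
  by (rule sets_PiM_cong) auto

lemma shift_lr_nonneg [simp]: "0 \<le> shift_lr I a x"
  by (simp add: shift_lr_def)

lemma shift_lr_measurable [measurable]: 
  "shift_lr I a \<in> borel_measurable (\<Pi>\<^sub>M i\<in>I. std_gauss)"
  unfolding shift_lr_def [abs_def] by measurable

text \<open>The one-dimensional Cameron--Martin formula: completing the square turns the density at
  \<open>t + x\<close> times the exponential weight into the density at \<open>x\<close>.\<close>

lemma distr_std_gauss_shift:
  "distr std_gauss borel (\<lambda>x. t + x) = density std_gauss (\<lambda>x. ennreal (exp (t * x - t\<^sup>2 / 2)))"
proof (rule measure_eqI)
  fix A assume "A \<in> sets (distr std_gauss borel (\<lambda>x. t + x))"
  then have A [measurable]: "A \<in> sets borel" by simp
  have dens: "ennreal (std_normal_density (t + x)) * ennreal (exp (t * (t + x) - t\<^sup>2 / 2))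
      = ennreal (std_normal_density x)" for x
    by (simp add: std_normal_density_def flip: ennreal_mult exp_add)
       (simp add: power2_eq_square field_simps)
  have "emeasure (density std_gauss (\<lambda>x. ennreal (exp (t * x - t\<^sup>2 / 2)))) A
      = (\<integral>\<^sup>+x. ennreal (std_normal_density x) * ennreal (exp (t * x - t\<^sup>2 / 2)) * indicator A x \<partial>lborel)"
    by (simp add: emeasure_density nn_integral_density mult.assoc)
  also have "\<dots> = (\<integral>\<^sup>+x. ennreal (std_normal_density (t + x)) *
      ennreal (exp (t * (t + x) - t\<^sup>2 / 2)) * indicator A (t + x) \<partial>lborel)"
    by (subst nn_integral_real_affine[of _ 1 t]) simp_all
  also have "\<dots> = (\<integral>\<^sup>+x. ennreal (std_normal_density x) * indicator ((\<lambda>x. t + x) -` A) x \<partial>lborel)"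
    unfolding dens by (simp add: indicator_def vimage_def)
  also have "\<dots> = emeasure (distr std_gauss borel (\<lambda>x. t + x)) A"
    by (subst emeasure_distr, simp, simp, subst emeasure_density)
       (use measurable_sets[of "\<lambda>x. t + x" borel borel A] in auto)
  finally show "emeasure (distr std_gauss borel (\<lambda>x. t + x)) A
      = emeasure (density std_gauss (\<lambda>x. ennreal (exp (t * x - t\<^sup>2 / 2)))) A" ..
qed simp

text \<open>Both sides are the product of the shifted one-dimensional laws: on a box, the left one because
  the shift acts coordinatewise, the right one because the likelihood ratio factorizes.\<close>

lemma gauss_shift_eq_density:
  assumes I: "finite I"
  shows "gauss_shift I a = density (\<Pi>\<^sub>M i\<in>I. std_gauss) (\<lambda>x. ennreal (shift_lr I a x))"
proof -
  define f where "f i x = ennreal (exp (a i * x - (a i)\<^sup>2 / 2))" for i x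
  define N where "N i = density std_gauss (f i)" for i
  have f_meas [measurable]: "f i \<in> borel_measurable borel" for i
    unfolding f_def by measurable
  have N: "N i = distr std_gauss borel (\<lambda>x. a i + x)" for i
    unfolding N_def f_def by (rule distr_std_gauss_shift [symmetric])
  interpret G: prob_space std_gauss by (rule prob_space_std_gauss)
  interpret PG: product_sigma_finite "\<lambda>_. std_gauss" ..
  have "prob_space (N i)" for i
    unfolding N by (rule G.prob_space_distr) simp
  then interpret PN: product_sigma_finite N
    by (simp add: product_sigma_finite_def prob_space_imp_sigma_finite)
  have sets_N: "sets (\<Pi>\<^sub>M i\<in>I. borel) = sets (PiM I N)"
    by (rule sets_PiM_cong) (auto simp: N_def)
  have "gauss_shift I a = PiM I N"
  proof (rule PN.PiM_eqI [OF I])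
    show "sets (gauss_shift I a) = sets (PiM I N)"
      by (simp add: gauss_shift_def sets_N)
    fix A assume "\<And>i. i \<in> I \<Longrightarrow> A i \<in> sets (N i)"
    then have A: "A i \<in> sets borel" if "i \<in> I" for i
      using that by (simp add: N_def)
    have pre: "(\<lambda>x. a i + x) -` A i \<in> sets borel" if "i \<in> I" for i
      using measurable_sets[of "\<lambda>x. a i + x" borel borel "A i"] A[OF that] by simp
    have "emeasure (gauss_shift I a) (Pi\<^sub>E I A)
        = emeasure (\<Pi>\<^sub>M i\<in>I. std_gauss)
            ((\<lambda>E. \<lambda>i\<in>I. a i + E i) -` Pi\<^sub>E I A \<inter> space (\<Pi>\<^sub>M i\<in>I. std_gauss))"
      unfolding gauss_shift_def
    proof (rule emeasure_distr)
      show "(\<lambda>E. \<lambda>i\<in>I. a i + E i) \<in> (\<Pi>\<^sub>M i\<in>I. std_gauss) \<rightarrow>\<^sub>M (\<Pi>\<^sub>M i\<in>I. borel)"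
        by measurable
      show "Pi\<^sub>E I A \<in> sets (\<Pi>\<^sub>M i\<in>I. borel)"
        using A by (intro sets_PiM_I_finite I) auto
    qed
    also have "(\<lambda>E. \<lambda>i\<in>I. a i + E i) -` Pi\<^sub>E I A \<inter> space (\<Pi>\<^sub>M i\<in>I. std_gauss)
        = (\<Pi>\<^sub>E i\<in>I. (\<lambda>x. a i + x) -` A i)"
      by (auto simp: space_PiM PiE_iff)
    also have "emeasure (\<Pi>\<^sub>M i\<in>I. std_gauss) \<dots>
        = (\<Prod>i\<in>I. emeasure std_gauss ((\<lambda>x. a i + x) -` A i))"
      using pre by (intro PG.emeasure_PiM I) auto
    also have "\<dots> = (\<Prod>i\<in>I. emeasure (N i) (A i))"
      using A by (intro prod.cong) (auto simp: N emeasure_distr)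
    finally show "emeasure (gauss_shift I a) (Pi\<^sub>E I A) = (\<Prod>i\<in>I. emeasure (N i) (A i))" .
  qed
  moreover have "density (\<Pi>\<^sub>M i\<in>I. std_gauss) (\<lambda>x. ennreal (shift_lr I a x)) = PiM I N"
  proof (rule PN.PiM_eqI [OF I])
    show "sets (density (\<Pi>\<^sub>M i\<in>I. std_gauss) (\<lambda>x. ennreal (shift_lr I a x))) = sets (PiM I N)"
      by (simp add: sets_PiM_std_gauss sets_N)
    fix A assume "\<And>i. i \<in> I \<Longrightarrow> A i \<in> sets (N i)"
    then have A: "A i \<in> sets borel" if "i \<in> I" for i
      using that by (simp add: N_def)
    have AP: "Pi\<^sub>E I A \<in> sets (\<Pi>\<^sub>M i\<in>I. std_gauss)"
      using A by (intro sets_PiM_I_finite I) auto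
    \<comment> \<open>A point of the product space is extensional, so membership in the box is decided
      coordinate by coordinate.\<close>
    have split: "ennreal (shift_lr I a x) * indicator (Pi\<^sub>E I A) x
        = (\<Prod>i\<in>I. f i (x i) * indicator (A i) (x i))"
      if "x \<in> space (\<Pi>\<^sub>M i\<in>I. std_gauss)" for x
    proof -
      have "x \<in> extensional I" using that by (simp add: space_PiM PiE_iff)
      then have "indicator (Pi\<^sub>E I A) x = (\<Prod>i\<in>I. indicator (A i) (x i) :: ennreal)"
        using I by (auto simp: indicator_def PiE_iff prod_zero_iff split: if_splits)
      moreover have "ennreal (shift_lr I a x) = (\<Prod>i\<in>I. f i (x i))"
        unfolding shift_lr_def f_def exp_sum [OF I] by (simp add: prod_ennreal)
      ultimately show ?thesis by (simp add: prod.distrib)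
    qed
    have "emeasure (density (\<Pi>\<^sub>M i\<in>I. std_gauss) (\<lambda>x. ennreal (shift_lr I a x))) (Pi\<^sub>E I A)
        = (\<integral>\<^sup>+x. ennreal (shift_lr I a x) * indicator (Pi\<^sub>E I A) x \<partial>(\<Pi>\<^sub>M i\<in>I. std_gauss))"
      using AP by (intro emeasure_density) auto
    also have "\<dots> = (\<integral>\<^sup>+x. (\<Prod>i\<in>I. f i (x i) * indicator (A i) (x i)) \<partial>(\<Pi>\<^sub>M i\<in>I. std_gauss))"
      by (intro nn_integral_cong split)
    also have "\<dots> = (\<Prod>i\<in>I. \<integral>\<^sup>+x. f i x * indicator (A i) x \<partial>std_gauss)"
      using A by (intro PG.product_nn_integral_prod [OF I]) simp
    also have "\<dots> = (\<Prod>i\<in>I. emeasure (N i) (A i))"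
      using A by (intro prod.cong) (auto simp: N_def emeasure_density)
    finally show "emeasure (density (\<Pi>\<^sub>M i\<in>I. std_gauss) (\<lambda>x. ennreal (shift_lr I a x))) (Pi\<^sub>E I A)
        = (\<Prod>i\<in>I. emeasure (N i) (A i))" .
  qed
  ultimately show ?thesis by simp
qed

lemma prob_space_PiM_std_gauss: "prob_space (\<Pi>\<^sub>M i\<in>I. std_gauss)"
  by (rule prob_space_PiM) (rule prob_space_std_gauss)

lemma nn_integral_gauss_shift:
  assumes "finite I" and "g \<in> borel_measurable (\<Pi>\<^sub>M i\<in>I. borel)"
  shows "(\<integral>\<^sup>+x. g x \<partial>gauss_shift I a)
    = (\<integral>\<^sup>+x. ennreal (shift_lr I a x) * g x \<partial>(\<Pi>\<^sub>M i\<in>I. std_gauss))"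
  unfolding gauss_shift_eq_density [OF assms(1)]
  using assms(2) by (intro nn_integral_density) 
    (auto simp: measurable_cong_sets [OF sets_PiM_std_gauss refl])

lemma nn_integral_shift_lr:
  assumes "finite I"
  shows "(\<integral>\<^sup>+x. ennreal (shift_lr I a x) \<partial>(\<Pi>\<^sub>M i\<in>I. std_gauss)) = 1"
proof -
  interpret prob_space "\<Pi>\<^sub>M i\<in>I. std_gauss" by (rule prob_space_PiM_std_gauss)
  have "prob_space (gauss_shift I a)"
    unfolding gauss_shift_def by (rule prob_space_distr) measurable
  then show ?thesis
    using nn_integral_gauss_shift [OF assms, of "\<lambda>_. 1" a]
    by (simp add: prob_space.emeasure_space_1)
qed

text \<open>The product of two likelihood ratios is, up to the constant \<open>exp \<langle>a, b\<rangle>\<close>, the likelihood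
  ratio of the shift \<open>a + b\<close>, whose mean is 1. This makes the second moment of a mixture explicit.\<close>

lemma nn_integral_shift_lr_mult:
  assumes "finite I"
  shows "(\<integral>\<^sup>+x. ennreal (shift_lr I a x * shift_lr I b x) \<partial>(\<Pi>\<^sub>M i\<in>I. std_gauss))
    = ennreal (exp (\<Sum>i\<in>I. a i * b i))"
proof -
  have "shift_lr I a x * shift_lr I b x
      = exp (\<Sum>i\<in>I. a i * b i) * shift_lr I (\<lambda>i. a i + b i) x" for x
    unfolding shift_lr_def exp_add [symmetric] sum.distrib [symmetric]
    by (simp add: algebra_simps power2_eq_square add_divide_distrib diff_divide_distrib)
  then show ?thesis
    by (simp add: ennreal_mult nn_integral_cmult nn_integral_shift_lr [OF assms])
qed

section \<open>Testing against a finite mixture\<close>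

text \<open>
  The null parameter 0 and an alternative with parameter \<open>r\<close> and likelihood ratio \<open>L\<close> are compared.
  By the triangle inequality, \<open>r min(1, L) \<le> \<bar>T\<bar> + L \<bar>T - r\<bar>\<close>, so the sum of the two risks is at
  least \<open>r\<close> times the mean of \<open>min(1, L)\<close>. The minorant \<open>L - L\<^sup>2/4\<close> of \<open>min(1, L)\<close> brings in the second
  moment: it has mean at least \<open>1 - 2/4\<close>.
\<close>

lemma (in prob_space) two_point_risk_bound:
  fixes L T :: "'a \<Rightarrow> real" and r :: real
  assumes [measurable]: "L \<in> borel_measurable M" "T \<in> borel_measurable M"
    and L0: "\<And>x. L x \<ge> 0" and r: "r \<ge> 0"
    and L1: "(\<integral>\<^sup>+x. ennreal (L x) \<partial>M) = 1"
    and L2: "(\<integral>\<^sup>+x. ennreal ((L x)\<^sup>2) \<partial>M) \<le> 2"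
  shows "ennreal (r / 2) \<le> (\<integral>\<^sup>+x. ennreal \<bar>T x\<bar> \<partial>M) + (\<integral>\<^sup>+x. ennreal (L x) * ennreal \<bar>T x - r\<bar> \<partial>M)"
    (is "_ \<le> ?X")
proof -
  have pointwise: "r * L x \<le> \<bar>T x\<bar> + L x * \<bar>T x - r\<bar> + r / 4 * (L x)\<^sup>2" for x
  proof -
    define m where "m = L x - (L x)\<^sup>2 / 4"
    have m1: "m \<le> 1"
      \<comment> \<open>\<open>1 - L + L\<^sup>2/4\<close> is a square.\<close>
      using zero_le_power2 [of "L x / 2 - 1"] by (simp add: m_def power2_eq_square field_simps)
    have mL: "m \<le> L x" by (simp add: m_def)
    have "r * m \<le> \<bar>T x\<bar> + L x * \<bar>T x - r\<bar>"
    proof (cases "m \<ge> 0")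
      case True
      have "r * m \<le> (\<bar>T x\<bar> + \<bar>T x - r\<bar>) * m"
        using True r by (intro mult_right_mono) linarith
      also have "\<dots> \<le> \<bar>T x\<bar> * 1 + \<bar>T x - r\<bar> * L x"
        unfolding distrib_right using m1 mL by (intro add_mono mult_left_mono) auto
      finally show ?thesis by (simp add: mult.commute)
    next
      case False
      then have "r * m \<le> 0" using r by (simp add: mult_nonneg_nonpos)
      also have "0 \<le> \<bar>T x\<bar> + L x * \<bar>T x - r\<bar>" using L0 by simp
      finally show ?thesis .
    qed
    then show ?thesis by (simp add: m_def algebra_simps)
  qed
  \<comment> \<open>The square is kept on the right-hand side, as subtraction is truncated in \<open>ennreal\<close>.\<close>
  have "ennreal r = (\<integral>\<^sup>+x. ennreal (r * L x) \<partial>M)"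
    using r L0 L1 by (simp add: ennreal_mult nn_integral_cmult)
  also have "\<dots> \<le> (\<integral>\<^sup>+x. ennreal \<bar>T x\<bar> + ennreal (L x) * ennreal \<bar>T x - r\<bar>
      + ennreal (r / 4) * ennreal ((L x)\<^sup>2) \<partial>M)"
    using r L0 pointwise
    by (intro nn_integral_mono) (simp add: ennreal_leI flip: ennreal_mult ennreal_plus)
  also have "\<dots> = ?X + ennreal (r / 4) * (\<integral>\<^sup>+x. ennreal ((L x)\<^sup>2) \<partial>M)"
    by (simp add: nn_integral_add nn_integral_cmult)
  also have "\<dots> \<le> ?X + ennreal (r / 4) * ennreal 2"
    using L2 by (intro add_left_mono mult_left_mono) auto
  also have "\<dots> = ?X + ennreal (r / 2)"
    using r by (subst ennreal_mult [symmetric]) auto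
  finally have main: "ennreal r \<le> ?X + ennreal (r / 2)" .
  show ?thesis
  proof (cases ?X)
    case (real X)
    then have "ennreal r \<le> ennreal (X + r / 2)"
      using main r by (simp add: ennreal_plus)
    then have "r / 2 \<le> X" using real r by (simp add: ennreal_le_iff del: ennreal_plus)
    then show ?thesis unfolding real by (rule ennreal_leI)
  next
    case top
    show ?thesis unfolding top by simp
  qed
qed

text \<open>
  The alternative is now the uniform mixture of the shifts \<open>a \<theta>\<close>, and the double sum in the hypothesis
  is the second moment of its likelihood ratio, up to normalization. The risk averaged over the
  mixture is at most the largest of the risks, whence the bound \<open>r / 2 \<le> R + R\<close>.
\<close>

lemma mixture_risk_bound:
  fixes a :: "'t \<Rightarrow> 'i \<Rightarrow> real" and T :: "('i \<Rightarrow> real) \<Rightarrow> real"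
  assumes I: "finite I" and \<Theta>: "finite \<Theta>" "\<Theta> \<noteq> {}" and r: "r \<ge> 0"
    and T: "T \<in> borel_measurable (\<Pi>\<^sub>M i\<in>I. borel)"
    and chi: "(\<Sum>\<theta>\<in>\<Theta>. \<Sum>\<theta>'\<in>\<Theta>. exp (\<Sum>i\<in>I. a \<theta> i * a \<theta>' i)) \<le> 2 * (real (card \<Theta>))\<^sup>2"
    and R0: "(\<integral>\<^sup>+x. ennreal \<bar>T x\<bar> \<partial>gauss_shift I (\<lambda>_. 0)) \<le> R"
    and R1: "\<And>\<theta>. \<theta> \<in> \<Theta> \<Longrightarrow> (\<integral>\<^sup>+x. ennreal \<bar>T x - r\<bar> \<partial>gauss_shift I (a \<theta>)) \<le> R"
  shows "ennreal (r / 4) \<le> R"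
proof -
  define M where "M = (\<Pi>\<^sub>M i\<in>I. std_gauss)"
  define n where "n = real (card \<Theta>)"
  define L where "L x = (\<Sum>\<theta>\<in>\<Theta>. shift_lr I (a \<theta>) x) / n" for x
  interpret M: prob_space M unfolding M_def by (rule prob_space_PiM_std_gauss)
  have n: "n > 0" using \<Theta> by (simp add: n_def card_gt_0_iff)
  have [measurable]: "shift_lr I b \<in> borel_measurable M" for b
    unfolding M_def by measurable
  have T' [measurable]: "T \<in> borel_measurable M"
    using T by (simp add: M_def measurable_cong_sets [OF sets_PiM_std_gauss refl])
  have L_meas [measurable]: "L \<in> borel_measurable M"
    unfolding L_def by measurable
  have L_weighted: "ennreal (L x) * c = ennreal (1 / n) * (\<Sum>\<theta>\<in>\<Theta>. ennreal (shift_lr I (a \<theta>) x) * c)"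
    for x c
  proof -
    have "ennreal (L x) = ennreal (1 / n) * (\<Sum>\<theta>\<in>\<Theta>. ennreal (shift_lr I (a \<theta>) x))"
      using n by (simp add: L_def sum_nonneg flip: ennreal_mult)
    then show ?thesis by (simp add: sum_distrib_right mult.assoc del: sum_ennreal)
  qed
  have avg: "ennreal (1 / n) * (\<Sum>\<theta>\<in>\<Theta>. c) = c" for c :: ennreal
  proof -
    have "ennreal (1 / n) * (\<Sum>\<theta>\<in>\<Theta>. c) = (ennreal (1 / n) * ennreal n) * c"
      by (simp add: n_def mult.assoc ennreal_of_nat_eq_real_of_nat)
    also have "ennreal (1 / n) * ennreal n = 1"
      using n by (subst ennreal_mult [symmetric]) auto
    finally show ?thesis by simp
  qed
  have mean: "(\<integral>\<^sup>+x. ennreal (L x) * g x \<partial>M)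
      = ennreal (1 / n) * (\<Sum>\<theta>\<in>\<Theta>. \<integral>\<^sup>+x. ennreal (shift_lr I (a \<theta>) x) * g x \<partial>M)"
    if [measurable]: "g \<in> borel_measurable M" for g
    unfolding L_weighted by (simp add: nn_integral_cmult nn_integral_sum)
  have "ennreal (r / 2) \<le> (\<integral>\<^sup>+x. ennreal \<bar>T x\<bar> \<partial>M)
      + (\<integral>\<^sup>+x. ennreal (L x) * ennreal \<bar>T x - r\<bar> \<partial>M)"
  proof (rule M.two_point_risk_bound [OF L_meas T' _ r])
    show "L x \<ge> 0" for x using n by (simp add: L_def sum_nonneg)
    show "(\<integral>\<^sup>+x. ennreal (L x) \<partial>M) = 1"
      using mean [of "\<lambda>_. 1"] nn_integral_shift_lr [OF I] avg [of 1] by (simp add: M_def)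
    have sq: "(L x)\<^sup>2 = 1 / n\<^sup>2 * (\<Sum>\<theta>\<in>\<Theta>. \<Sum>\<theta>'\<in>\<Theta>. shift_lr I (a \<theta>) x * shift_lr I (a \<theta>') x)" for x
      by (simp add: L_def power_divide power2_eq_square sum_product)
    have "(\<integral>\<^sup>+x. ennreal ((L x)\<^sup>2) \<partial>M) = ennreal (1 / n\<^sup>2) *
        (\<Sum>\<theta>\<in>\<Theta>. \<Sum>\<theta>'\<in>\<Theta>. \<integral>\<^sup>+x. ennreal (shift_lr I (a \<theta>) x * shift_lr I (a \<theta>') x) \<partial>M)"
      unfolding sq using n
      by (subst ennreal_mult) (auto simp: sum_nonneg nn_integral_cmult nn_integral_sum simp flip: sum_ennreal)
    also have "\<dots> = ennreal (1 / n\<^sup>2 * (\<Sum>\<theta>\<in>\<Theta>. \<Sum>\<theta>'\<in>\<Theta>. exp (\<Sum>i\<in>I. a \<theta> i * a \<theta>' i)))"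
      using n by (subst ennreal_mult) (auto simp: M_def nn_integral_shift_lr_mult [OF I] sum_nonneg)
    also have "\<dots> \<le> ennreal 2"
      using n chi by (intro ennreal_leI) (simp add: n_def field_simps)
    finally show "(\<integral>\<^sup>+x. ennreal ((L x)\<^sup>2) \<partial>M) \<le> 2" by simp
  qed
  also have "(\<integral>\<^sup>+x. ennreal \<bar>T x\<bar> \<partial>M) = (\<integral>\<^sup>+x. ennreal \<bar>T x\<bar> \<partial>gauss_shift I (\<lambda>_. 0))"
    using T by (subst nn_integral_gauss_shift [OF I]) (auto simp: M_def shift_lr_def)
  also have "(\<integral>\<^sup>+x. ennreal (L x) * ennreal \<bar>T x - r\<bar> \<partial>M)
      = ennreal (1 / n) * (\<Sum>\<theta>\<in>\<Theta>. \<integral>\<^sup>+x. ennreal \<bar>T x - r\<bar> \<partial>gauss_shift I (a \<theta>))"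
    using T by (subst mean) (auto simp: M_def nn_integral_gauss_shift [OF I])
  also have "(\<integral>\<^sup>+x. ennreal \<bar>T x\<bar> \<partial>gauss_shift I (\<lambda>_. 0)) + \<dots>
      \<le> R + ennreal (1 / n) * (\<Sum>\<theta>\<in>\<Theta>. R)"
    using R0 R1 by (intro add_mono mult_left_mono sum_mono) auto
  also have "\<dots> = R + R" by (simp only: avg)
  finally have main: "ennreal (r / 2) \<le> R + R" .
  show ?thesis
  proof (cases R)
    case (real \<rho>)
    then have "r / 2 \<le> \<rho> + \<rho>" using main r by (simp flip: ennreal_plus)
    then show ?thesis unfolding real by (intro ennreal_leI) simp
  qed simp
qed

section \<open>Exponential moments of random signs\<close>

definition signs :: "nat \<Rightarrow> (nat \<Rightarrow> real) set" where
  "signs n = (\<Pi>\<^sub>E i\<in>{..<n}. {-1, 1})"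

lemma finite_signs: "finite (signs n)"
  by (simp add: signs_def finite_PiE)

lemma card_signs: "card (signs n) = 2 ^ n"
  by (simp add: signs_def card_PiE numeral_2_eq_2)

lemma signs_cases: "\<epsilon> \<in> signs n \<Longrightarrow> i < n \<Longrightarrow> \<epsilon> i = -1 \<or> \<epsilon> i = 1"
  by (auto simp: signs_def PiE_iff)

text \<open>This is Hoeffding's lemma for a random sign: the function in the library lemma, at
  \<open>h = 2 t\<close> and \<open>p = 1/2\<close>, is \<open>ln (cosh t)\<close>.\<close>

lemma cosh_le_exp_half_square: "cosh t \<le> exp (t\<^sup>2 / 2)" for t :: real
proof -
  have *: "cosh t \<le> exp (t\<^sup>2 / 2)" if "t \<ge> 0" for t :: real
  proof -
    have "1 + 1 / 2 * (exp (2 * t) - 1) = exp t * cosh t"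
      by (simp add: cosh_def field_simps flip: exp_add)
    then have "ln (cosh t) \<le> t\<^sup>2 / 2"
      using Hoeffdings_lemma_aux [of "2 * t" "1 / 2"] that
      by (simp add: ln_mult power_mult_distrib)
    then show ?thesis
      by (metis cosh_real_pos exp_le_cancel_iff exp_ln)
  qed
  show ?thesis using * [of t] * [of "- t"] by (cases "t \<ge> 0") auto
qed

text \<open>
  Subgaussianity of the inner product of a random sign vector with a fixed sign vector \<open>\<delta>\<close>. The sum
  over all sign vectors factorizes over the coordinates, and by symmetry no factor depends on \<open>\<delta>\<close>.
\<close>

lemma sum_signs_exp_le:
  assumes \<delta>: "\<delta> \<in> signs n"
  shows "(\<Sum>\<epsilon>\<in>signs n. exp (t * (\<Sum>i<n. \<epsilon> i * \<delta> i))) \<le> 2 ^ n * exp (real n * t\<^sup>2 / 2)"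
proof -
  have "(\<Sum>\<epsilon>\<in>signs n. exp (t * (\<Sum>i<n. \<epsilon> i * \<delta> i)))
      = (\<Sum>\<epsilon>\<in>signs n. \<Prod>i<n. exp (t * (\<epsilon> i * \<delta> i)))"
    by (simp add: sum_distrib_left exp_sum)
  also have "\<dots> = (\<Prod>i<n. \<Sum>e\<in>{-1, 1}. exp (t * (e * \<delta> i)))"
    unfolding signs_def by (subst prod_sum_PiE) auto
  also have "\<dots> = (\<Prod>i<n. 2 * cosh t)"
  proof (intro prod.cong refl)
    fix i assume "i \<in> {..<n}"
    then consider "\<delta> i = -1" | "\<delta> i = 1" using signs_cases [OF \<delta>] by auto
    then show "(\<Sum>e\<in>{-1, 1}. exp (t * (e * \<delta> i))) = 2 * cosh t"
      by cases (simp_all add: cosh_def)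
  qed
  also have "\<dots> \<le> (\<Prod>i<n. 2 * exp (t\<^sup>2 / 2))"
    by (intro prod_mono) (simp add: cosh_le_exp_half_square)
  also have "\<dots> = 2 ^ n * exp (real n * t\<^sup>2 / 2)"
    by (simp add: power_mult_distrib exp_of_nat_mult [symmetric])
  finally show ?thesis .
qed

lemma std_gauss_exp_linear:
  "(\<integral>\<^sup>+x. ennreal (exp (t * x)) \<partial>std_gauss) = ennreal (exp (t\<^sup>2 / 2))"
proof -
  interpret prob_space std_gauss by (rule prob_space_std_gauss)
  have "prob_space (density std_gauss (\<lambda>x. ennreal (exp (t * x - t\<^sup>2 / 2))))"
    unfolding distr_std_gauss_shift [symmetric] by (rule prob_space_distr) simp
  then have "(\<integral>\<^sup>+x. ennreal (exp (t * x - t\<^sup>2 / 2)) \<partial>std_gauss) = 1"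
    using prob_space.emeasure_space_1 by (fastforce simp: emeasure_density)
  moreover have "exp (t * x) = exp (t\<^sup>2 / 2) * exp (t * x - t\<^sup>2 / 2)" for x
    by (simp flip: exp_add)
  ultimately show ?thesis
    by (simp only: ennreal_mult exp_ge_zero nn_integral_cmult) (simp add: nn_integral_cmult)
qed

text \<open>The integrand is a multiple of the centred Gaussian density of variance 4/3: the exponents add up
  to \<open>- 3 x\<^sup>2 / 8\<close>. The exact value is \<open>2 / \<surd>3\<close>.\<close>

lemma std_gauss_exp_eighth_square:
  "(\<integral>\<^sup>+x. ennreal (exp (x\<^sup>2 / 8)) \<partial>std_gauss) \<le> 2"
proof -
  define \<sigma> :: real where "\<sigma> = 2 / sqrt 3"
  have \<sigma>: "\<sigma> > 0" "\<sigma>\<^sup>2 = 4 / 3" by (simp_all add: \<sigma>_def power_divide)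
  have "sqrt 3 \<ge> (1::real)" by simp
  then have \<sigma>2: "\<sigma> \<le> 2" by (simp add: \<sigma>_def divide_simps)
  have eq: "std_normal_density x * exp (x\<^sup>2 / 8) = \<sigma> * normal_density 0 \<sigma> x" for x
  proof -
    have "sqrt (2 * pi * \<sigma>\<^sup>2) = \<sigma> * sqrt (2 * pi)"
      using \<sigma>(1) by (simp add: real_sqrt_mult)
    moreover have "exp (- x\<^sup>2 / 2) * exp (x\<^sup>2 / 8) = exp (- (x - 0)\<^sup>2 / (2 * \<sigma>\<^sup>2))"
      unfolding \<sigma>(2) by (simp flip: exp_add)
    ultimately show ?thesis
      using \<sigma>(1) by (simp add: std_normal_density_def normal_density_def)
  qed
  have "(\<integral>\<^sup>+x. ennreal (exp (x\<^sup>2 / 8)) \<partial>std_gauss)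
      = (\<integral>\<^sup>+x. ennreal (std_normal_density x * exp (x\<^sup>2 / 8)) \<partial>lborel)"
    by (simp add: nn_integral_density ennreal_mult)
  also have "\<dots> = ennreal \<sigma> * (\<integral>\<^sup>+x. ennreal (normal_density 0 \<sigma> x) \<partial>lborel)"
    unfolding eq using \<sigma>(1) by (simp add: ennreal_mult nn_integral_cmult)
  also have "(\<integral>\<^sup>+x. ennreal (normal_density 0 \<sigma> x) \<partial>lborel) = 1"
    using \<sigma>(1) by (simp add: nn_integral_eq_integral)
  finally show ?thesis using \<sigma>2 by (simp add: ennreal_le_iff flip: ennreal_numeral)
qed

text \<open>
  The square in the exponent is linearized by an auxiliary standard Gaussian variable \<open>x\<close>: the mean of
  \<open>exp (t W x)\<close> over \<open>x\<close> is \<open>exp (t\<^sup>2 W\<^sup>2 / 2)\<close>. After exchanging the two averages, subgaussianity of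
  \<open>W\<close> leaves a Gaussian integral in \<open>x\<close>.
\<close>

lemma sum_signs_exp_square_le:
  assumes \<delta>: "\<delta> \<in> signs n" and n: "n > 0"
  shows "(\<Sum>\<epsilon>\<in>signs n. exp ((\<Sum>i<n. \<epsilon> i * \<delta> i)\<^sup>2 / (8 * real n))) \<le> 2 * 2 ^ n"
proof -
  define t where "t = 1 / (2 * sqrt (real n))"
  define W where "W \<epsilon> = (\<Sum>i<n. \<epsilon> i * \<delta> i)" for \<epsilon>
  have t: "t\<^sup>2 = 1 / (4 * real n)" using n by (simp add: t_def power_divide power_mult_distrib)
  have W: "(W \<epsilon>)\<^sup>2 / (8 * real n) = (t * W \<epsilon>)\<^sup>2 / 2" for \<epsilon>
    by (simp add: power_mult_distrib t)
  have "ennreal (\<Sum>\<epsilon>\<in>signs n. exp ((W \<epsilon>)\<^sup>2 / (8 * real n)))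
      = (\<Sum>\<epsilon>\<in>signs n. \<integral>\<^sup>+x. ennreal (exp ((t * W \<epsilon>) * x)) \<partial>std_gauss)"
    unfolding W std_gauss_exp_linear by (rule sum_ennreal [symmetric]) simp
  also have "\<dots> = (\<integral>\<^sup>+x. (\<Sum>\<epsilon>\<in>signs n. ennreal (exp ((t * W \<epsilon>) * x))) \<partial>std_gauss)"
    by (rule nn_integral_sum [symmetric]) simp
  also have "\<dots> \<le> (\<integral>\<^sup>+x. ennreal (2 ^ n) * ennreal (exp (x\<^sup>2 / 8)) \<partial>std_gauss)"
  proof (rule nn_integral_mono)
    fix x :: real
    have tx: "real n * (t * x)\<^sup>2 / 2 = x\<^sup>2 / 8"
      using n by (simp add: power_mult_distrib t)
    have "(\<Sum>\<epsilon>\<in>signs n. exp ((t * W \<epsilon>) * x)) \<le> 2 ^ n * exp (x\<^sup>2 / 8)"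
      using sum_signs_exp_le [OF \<delta>, of "t * x", unfolded tx] by (simp add: W_def mult_ac)
    then show "(\<Sum>\<epsilon>\<in>signs n. ennreal (exp ((t * W \<epsilon>) * x))) \<le> ennreal (2 ^ n) * ennreal (exp (x\<^sup>2 / 8))"
      by (simp add: ennreal_leI flip: ennreal_mult)
  qed
  also have "\<dots> = ennreal (2 ^ n) * (\<integral>\<^sup>+x. ennreal (exp (x\<^sup>2 / 8)) \<partial>std_gauss)"
    by (rule nn_integral_cmult) simp
  also have "\<dots> \<le> ennreal (2 ^ n) * ennreal 2"
    using std_gauss_exp_eighth_square by (intro mult_left_mono) auto
  also have "\<dots> = ennreal (2 * 2 ^ n)"
    by (subst ennreal_mult [symmetric]) (auto simp: mult.commute)
  finally show ?thesis by (simp add: W_def ennreal_le_iff)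
qed

text \<open>Averaging over \<open>\<epsilon>\<close> at fixed \<open>\<eta>\<close> squares the inner product with \<open>\<zeta>\<close> in the exponent; the choice of
  \<open>s\<close> turns its coefficient \<open>p s^4 / 2\<close> into the \<open>1 / (8 q)\<close> of the preceding lemma.\<close>

lemma sum_signs_exp_bilinear_le:
  assumes \<delta>: "\<delta> \<in> signs p" and \<zeta>: "\<zeta> \<in> signs q" and q: "q > 0"
    and s: "s ^ 4 * real p * real q = 1 / 4"
  shows "(\<Sum>\<epsilon>\<in>signs p. \<Sum>\<eta>\<in>signs q.
      exp (s\<^sup>2 * (\<Sum>i<p. \<epsilon> i * \<delta> i) * (\<Sum>j<q. \<eta> j * \<zeta> j))) \<le> 2 * 2 ^ p * 2 ^ q"
proof -
  define W where "W \<eta> = (\<Sum>j<q. \<eta> j * \<zeta> j)" for \<eta>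
  have "real p * (s\<^sup>2 * w)\<^sup>2 / 2 = w\<^sup>2 / (8 * real q)" for w
  proof -
    have "real p * (s\<^sup>2 * w)\<^sup>2 / 2 = (s ^ 4 * real p * real q) * w\<^sup>2 / (2 * real q)"
      using q by (simp add: power_mult_distrib)
    then show ?thesis unfolding s by simp
  qed
  then have "(\<Sum>\<eta>\<in>signs q. \<Sum>\<epsilon>\<in>signs p. exp ((s\<^sup>2 * W \<eta>) * (\<Sum>i<p. \<epsilon> i * \<delta> i)))
      \<le> (\<Sum>\<eta>\<in>signs q. 2 ^ p * exp ((W \<eta>)\<^sup>2 / (8 * real q)))"
    using sum_signs_exp_le [OF \<delta>] by (intro sum_mono) metis
  also have "\<dots> \<le> 2 ^ p * (2 * 2 ^ q)"
    unfolding sum_distrib_left [symmetric] W_def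
    by (intro mult_left_mono sum_signs_exp_square_le [OF \<zeta> q]) simp
  finally show ?thesis
    by (subst sum.swap) (simp add: W_def mult_ac)
qed

section \<open>The lower bound over matrices of rank at most one\<close>

definition sign_matrix :: "nat \<Rightarrow> nat \<Rightarrow> real \<Rightarrow> (nat \<Rightarrow> real) \<Rightarrow> (nat \<Rightarrow> real) \<Rightarrow> real mat" where
  "sign_matrix p q s \<epsilon> \<eta> = mat p q (\<lambda>(i, j). s * \<epsilon> i * \<eta> j)"

lemma rank_sign_matrix: "vec_space.rank p (sign_matrix p q s \<epsilon> \<eta>) \<le> 1"
  by (rule vec_space.rank_le_1_product_entries [where f = "\<lambda>i. s * \<epsilon> i" and g = \<eta> and nc = q])
     (auto simp: sign_matrix_def)

lemma frobenius_norm_sign_matrix: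
  assumes "\<epsilon> \<in> signs p" "\<eta> \<in> signs q" "s \<ge> 0"
  shows "frobenius_norm (sign_matrix p q s \<epsilon> \<eta>) = s * sqrt (real p * real q)"
proof -
  have "(\<Sum>i<p. \<Sum>j<q. (sign_matrix p q s \<epsilon> \<eta> $$ (i, j))\<^sup>2) = (\<Sum>i<p. \<Sum>j<q. s\<^sup>2)"
    using signs_cases [OF assms(1)] signs_cases [OF assms(2)]
    by (intro sum.cong refl) (fastforce simp: sign_matrix_def power_mult_distrib)
  also have "\<dots> = s\<^sup>2 * (real p * real q)" by simp
  finally show ?thesis
    using assms(3) by (simp add: frobenius_norm_def sign_matrix_def real_sqrt_mult)
qed

lemma obs_law_eq_gauss_shift: "obs_law p q A = gauss_shift (entries p q) (\<lambda>ij. A $$ ij)"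
  by (simp add: obs_law_def gauss_shift_def noise_law_def obs_space_def)

text \<open>The inner product of two sign matrices splits into a product of inner products of their sign
  vectors, so the sums over signs above control the second moment in the mixture bound.\<close>

lemma sup_risk_ge:
  assumes pq: "p > 0" "q > 0" and T: "T \<in> borel_measurable (obs_space p q)"
  shows "ennreal (1 / (4 * sqrt 2) * (real p * real q) powr (1 / 4))
    \<le> (SUP A \<in> {A \<in> carrier_mat p q. vec_space.rank p A \<le> 1}. risk p q T A)"
    (is "_ \<le> ?R")
proof -
  define x where "x = real p * real q"
  define s where "s = x powr (- 1 / 4) / sqrt 2"
  define a where "a = (\<lambda>(\<epsilon>, \<eta>) ij. sign_matrix p q s \<epsilon> \<eta> $$ ij)"
  have x: "x > 0" using pq by (simp add: x_def)
  have s0: "s \<ge> 0" by (simp add: s_def)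
  have s4: "s ^ 4 * real p * real q = 1 / 4"
  proof -
    have "(x powr (- 1 / 4)) ^ 4 = x powr (-1)"
      using x by (simp add: powr_powr flip: powr_numeral)
    moreover have "sqrt 2 ^ 4 = (4::real)"
      using power_mult [of "sqrt 2 :: real" 2 2] by simp
    ultimately have "s ^ 4 * x = 1 / 4"
      using x by (simp add: s_def power_divide powr_minus)
    then show ?thesis by (simp add: x_def mult.assoc)
  qed
  have norm: "s * sqrt x = x powr (1 / 4) / sqrt 2"
    using x by (simp add: s_def powr_half_sqrt [symmetric] powr_add [symmetric])
  have risk_le: "(\<integral>\<^sup>+Y. ennreal \<bar>T Y - frobenius_norm A\<bar> \<partial>gauss_shift (entries p q) (\<lambda>ij. A $$ ij)) \<le> ?R"
    if "A \<in> carrier_mat p q" "vec_space.rank p A \<le> 1" for A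
    using that unfolding obs_law_eq_gauss_shift [symmetric] risk_def [symmetric]
    by (intro SUP_upper) simp
  have "ennreal (s * sqrt x / 4) \<le> ?R"
  proof (rule mixture_risk_bound [where I = "entries p q" and \<Theta> = "signs p \<times> signs q" and a = a and T = T])
    show "finite (entries p q)" by (simp add: entries_def)
    show "finite (signs p \<times> signs q)" by (simp add: finite_signs)
    show "signs p \<times> signs q \<noteq> {}" by (auto simp: signs_def PiE_eq_empty_iff)
    show "0 \<le> s * sqrt x" using s0 x by simp
    show "T \<in> borel_measurable (\<Pi>\<^sub>M i\<in>entries p q. borel)"
      using T by (simp add: obs_space_def)
    have inner: "(\<Sum>ij\<in>entries p q. a (\<epsilon>, \<eta>) ij * a (\<delta>, \<zeta>) ij)
        = s\<^sup>2 * (\<Sum>i<p. \<epsilon> i * \<delta> i) * (\<Sum>j<q. \<eta> j * \<zeta> j)" for \<epsilon> \<eta> \<delta> \<zeta>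
    proof -
      have "(\<Sum>ij\<in>entries p q. a (\<epsilon>, \<eta>) ij * a (\<delta>, \<zeta>) ij)
          = (\<Sum>i<p. \<Sum>j<q. s\<^sup>2 * ((\<epsilon> i * \<delta> i) * (\<eta> j * \<zeta> j)))"
        unfolding entries_def sum.cartesian_product
        by (intro sum.cong refl) (auto simp: a_def sign_matrix_def power2_eq_square)
      then show ?thesis
        unfolding mult.assoc [of "s\<^sup>2"] sum_product by (simp add: sum_distrib_left)
    qed
    have "(\<Sum>\<theta>\<in>signs p \<times> signs q. \<Sum>\<theta>'\<in>signs p \<times> signs q.
          exp (\<Sum>ij\<in>entries p q. a \<theta>' ij * a \<theta> ij))
        \<le> (\<Sum>\<theta>\<in>signs p \<times> signs q. 2 * 2 ^ p * 2 ^ q)"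
    proof (rule sum_mono)
      fix \<theta> assume "\<theta> \<in> signs p \<times> signs q"
      then obtain \<delta> \<zeta> where \<theta>: "\<theta> = (\<delta>, \<zeta>)" "\<delta> \<in> signs p" "\<zeta> \<in> signs q" by auto
      show "(\<Sum>\<theta>'\<in>signs p \<times> signs q. exp (\<Sum>ij\<in>entries p q. a \<theta>' ij * a \<theta> ij)) \<le> 2 * 2 ^ p * 2 ^ q"
        using sum_signs_exp_bilinear_le [OF \<theta>(2,3) pq(2) s4]
        by (simp add: \<theta>(1) inner sum.cartesian_product')
    qed
    also have "\<dots> = 2 * (real (card (signs p \<times> signs q)))\<^sup>2"
      by (simp add: card_cartesian_product card_signs power2_eq_square)
    finally show "(\<Sum>\<theta>\<in>signs p \<times> signs q. \<Sum>\<theta>'\<in>signs p \<times> signs q.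
        exp (\<Sum>ij\<in>entries p q. a \<theta> ij * a \<theta>' ij)) \<le> 2 * (real (card (signs p \<times> signs q)))\<^sup>2"
      by (simp add: mult.commute)
    \<comment> \<open>The entries of a matrix are specified only within its dimensions, so the two shifts agree
      on the index set but need not be equal as functions.\<close>
    have law0: "gauss_shift (entries p q) (\<lambda>ij. 0\<^sub>m p q $$ ij) = gauss_shift (entries p q) (\<lambda>_. 0)"
      unfolding gauss_shift_def
      by (intro distr_cong refl) (auto simp: entries_def restrict_def)
    have "vec_space.rank p (0\<^sub>m p q :: real mat) \<le> 1"
      by (rule vec_space.rank_le_1_product_entries [where f = "\<lambda>_. 0" and g = "\<lambda>_. 0" and nc = q]) auto
    then show "(\<integral>\<^sup>+Y. ennreal \<bar>T Y\<bar> \<partial>gauss_shift (entries p q) (\<lambda>_. 0)) \<le> ?R"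
      using risk_le [of "0\<^sub>m p q"] unfolding law0 by (simp add: frobenius_norm_def)
    fix \<theta> assume "\<theta> \<in> signs p \<times> signs q"
    then obtain \<epsilon> \<eta> where \<theta>: "\<theta> = (\<epsilon>, \<eta>)" "\<epsilon> \<in> signs p" "\<eta> \<in> signs q" by auto
    show "(\<integral>\<^sup>+Y. ennreal \<bar>T Y - s * sqrt x\<bar> \<partial>gauss_shift (entries p q) (a \<theta>)) \<le> ?R"
      using risk_le [of "sign_matrix p q s \<epsilon> \<eta>"] rank_sign_matrix [of p q s \<epsilon> \<eta>]
      by (simp add: \<theta>(1) a_def x_def frobenius_norm_sign_matrix [OF \<theta>(2,3) s0])
         (simp add: sign_matrix_def)
  qed
  then show ?thesis unfolding norm by (simp add: x_def mult.commute)
qed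

theorem proposition2p2:
  shows "\<exists>c::real. c > 0 \<and>
    (\<forall>p q :: nat. p \<ge> q \<and> q \<ge> 1 \<longrightarrow>
      (INF T \<in> borel_measurable (obs_space p q).
         SUP A \<in> {A \<in> carrier_mat p q. vec_space.rank p A \<le> 1}. risk p q T A)
      \<ge> ennreal (c * (real p * real q) powr (1 / 4)))"
proof (intro exI [of _ "1 / (4 * sqrt 2)"] conjI allI impI)
  show "1 / (4 * sqrt 2) > (0::real)" by simp
  fix p q :: nat assume "p \<ge> q \<and> q \<ge> 1"
  then show "(INF T \<in> borel_measurable (obs_space p q).
         SUP A \<in> {A \<in> carrier_mat p q. vec_space.rank p A \<le> 1}. risk p q T A)
      \<ge> ennreal (1 / (4 * sqrt 2) * (real p * real q) powr (1 / 4))"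
    by (intro INF_greatest sup_risk_ge) auto
qed

end
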